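(* Let $X$ be a semigroup, $Y$ a set, and let $R\subseteq X\times Y$ be a residuated relation from $X$ to $Y$. Then $\mathsf{M}R=\{A\subseteq X\mid A=R^{\downarrow}R^{\uparrow}(A)\}$, ordered by inclusion, is a quantale, with multiplication and suprema given by $$A\otimes_R B=R^{\downarrow}R^{\uparrow}(A*B),\qquad \bigsqcup_{i\in I}A_i=R^{\downarrow}R^{\uparrow}\Big(\bigcup_{i\in I}A_i\Big)$$ for all $A,B\in\mathsf{M}R$ and all families $\{A_i\}_{i\in I}$ in $\mathsf{M}R$. Moreover, the closure map $\mathsf{j}_R=R^{\downarrow}R^{\uparrow}\colon \mathsf{P}X\to\mathsf{M}R$ is a homomorphism of quantales.
   Context: A quantale is a complete lattice $Q$ with an associative binary operation $*$ preserving arbitrary suprema in each variable (no unit is assumed). A homomorphism of quantales is a map preserving arbitrary suprema and the multiplication. For a semigroup $X$ (product written $xx'$), $\mathsf{P}X$ is the quantale of all subsets of $X$ ordered by inclusion, with multiplication $A*B=\{ab\mid a\in A,\ b\in B\}$. A relation from a set $X$ to a set $Y$ is a subset $R\subseteq X\times Y$; $xRy$ means $(x,y)\in R$. For $A\subseteq X$ and $B\subseteq Y$ put $R^{\uparrow}(A)=\{y\in Y\mid \forall a\in A,\ aRy\}$ and $R^{\downarrow}(B)=\{x\in X\mid \forall b\in B,\ xRb\}$. For a semigroup $X$ and a set $Y$, a relation $R\subseteq X\times Y$ is residuated if there exist maps $\swarrow\colon Y\times X\to Y$ and $\searrow\colon X\times Y\to Y$ such that $(xx')Ry\iff xR(y\swarrow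 x')\iff x'R(x\searrow y)$ for all $x,x'\in X$, $y\in Y$. *)

theory Defs
  imports "HOL-Algebra.Complete_Lattice"
begin

locale semigroup_on =
  fixes X :: "'a set" and f :: "'a \<Rightarrow> 'a \<Rightarrow> 'a"
  assumes closed: "\<lbrakk>x \<in> X; y \<in> X\<rbrakk> \<Longrightarrow> f x y \<in> X"
    and assoc: "\<lbrakk>x \<in> X; y \<in> X; z \<in> X\<rbrakk> \<Longrightarrow> f (f x y) z = f x (f y z)"

record 'a quantale = "'a gorder" +
  qmult :: "'a \<Rightarrow> 'a \<Rightarrow> 'a"  (infixl \<open>\<otimes>\<index>\<close> 70)

text \<open>The set of elements whose supremum is taken may be empty, so multiplication and
  homomorphisms also preserve the bottom element.\<close>

locale quantale = complete_lattice Q for Q (structure) +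
  assumes mult_closed: "\<lbrakk>a \<in> carrier Q; b \<in> carrier Q\<rbrakk> \<Longrightarrow> a \<otimes> b \<in> carrier Q"
    and mult_assoc: "\<lbrakk>a \<in> carrier Q; b \<in> carrier Q; c \<in> carrier Q\<rbrakk>
      \<Longrightarrow> (a \<otimes> b) \<otimes> c = a \<otimes> (b \<otimes> c)"
    and mult_Sup_right: "\<lbrakk>a \<in> carrier Q; S \<subseteq> carrier Q\<rbrakk>
      \<Longrightarrow> a \<otimes> (\<Squnion>S) = \<Squnion>((\<lambda>s. a \<otimes> s) ` S)"
    and mult_Sup_left: "\<lbrakk>a \<in> carrier Q; S \<subseteq> carrier Q\<rbrakk>
      \<Longrightarrow> (\<Squnion>S) \<otimes> a = \<Squnion>((\<lambda>s. s \<otimes> a) ` S)"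

locale quantale_hom = source: quantale P + target: quantale Q
  for P (structure) and Q (structure) +
  fixes h
  assumes hom_closed: "a \<in> carrier P \<Longrightarrow> h a \<in> carrier Q"
    and hom_Sup: "S \<subseteq> carrier P \<Longrightarrow> h (\<Squnion>\<^bsub>P\<^esub> S) = \<Squnion>\<^bsub>Q\<^esub> (h ` S)"
    and hom_mult: "\<lbrakk>a \<in> carrier P; b \<in> carrier P\<rbrakk>
      \<Longrightarrow> h (a \<otimes>\<^bsub>P\<^esub> b) = h a \<otimes>\<^bsub>Q\<^esub> h b"

definition subset_mult :: "('a \<Rightarrow> 'a \<Rightarrow> 'a) \<Rightarrow> 'a set \<Rightarrow> 'a set \<Rightarrow> 'a set"
  where "subset_mult f A B = {f a b | a b. a \<in> A \<and> b \<in> B}"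

definition powerset_quantale :: "'a set \<Rightarrow> ('a \<Rightarrow> 'a \<Rightarrow> 'a) \<Rightarrow> 'a set quantale"
  where "powerset_quantale X f =
    \<lparr>carrier = Pow X, eq = (=), le = (\<subseteq>), qmult = subset_mult f\<rparr>"

text \<open>A relation from \<open>X\<close> to \<open>Y\<close> does not determine \<open>X\<close> and \<open>Y\<close>, which are therefore
  parameters of the polar operators: for instance, the upper polar of the empty set is \<open>Y\<close>.\<close>

definition up_polar :: "'b set \<Rightarrow> ('a \<times> 'b) set \<Rightarrow> 'a set \<Rightarrow> 'b set"
  where "up_polar Y R A = {y \<in> Y. \<forall>a\<in>A. (a, y) \<in> R}"

definition down_polar :: "'a set \<Rightarrow> ('a \<times> 'b) set \<Rightarrow> 'b set \<Rightarrow> 'a set"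
  where "down_polar X R B = {x \<in> X. \<forall>b\<in>B. (x, b) \<in> R}"

definition polar_closure :: "'a set \<Rightarrow> 'b set \<Rightarrow> ('a \<times> 'b) set \<Rightarrow> 'a set \<Rightarrow> 'a set"
  where "polar_closure X Y R A = down_polar X R (up_polar Y R A)"

definition residuated :: "'a set \<Rightarrow> ('a \<Rightarrow> 'a \<Rightarrow> 'a) \<Rightarrow> 'b set \<Rightarrow> ('a \<times> 'b) set \<Rightarrow> bool"
  where "residuated X f Y R \<longleftrightarrow>
    (\<exists>(l :: 'b \<Rightarrow> 'a \<Rightarrow> 'b) (r :: 'a \<Rightarrow> 'b \<Rightarrow> 'b).
      (\<forall>y\<in>Y. \<forall>x\<in>X. l y x \<in> Y) \<and> (\<forall>x\<in>X. \<forall>y\<in>Y. r x y \<in> Y) \<and>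
      (\<forall>x\<in>X. \<forall>x'\<in>X. \<forall>y\<in>Y.
        ((f x x', y) \<in> R \<longleftrightarrow> (x, l y x') \<in> R) \<and>
        ((x, l y x') \<in> R \<longleftrightarrow> (x', r x y) \<in> R)))"

definition polar_quantale :: "'a set \<Rightarrow> ('a \<Rightarrow> 'a \<Rightarrow> 'a) \<Rightarrow> 'b set \<Rightarrow> ('a \<times> 'b) set \<Rightarrow> 'a set quantale"
  where "polar_quantale X f Y R =
    \<lparr>carrier = {A. A \<subseteq> X \<and> A = polar_closure X Y R A}, eq = (=), le = (\<subseteq>),
     qmult = (\<lambda>A B. polar_closure X Y R (subset_mult f A B))\<rparr>"

end

theory Submission
  imports Defs
begin

text \<open>A residual of \<open>y\<close> turns the statement that \<open>x x'\<close> lies in a polar into the statement that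
  one factor lies in a polar. Hence the closure \<open>j\<close> satisfies \<open>j A * j B \<subseteq> j (A * B)\<close>, that is, it is
  a nucleus on the powerset quantale. Multiplying and joining modulo \<open>j\<close> on the fixed points of
  any nucleus gives a quantale, because \<open>j\<close> may be inserted before or after each operation
  without changing the final closure. The powerset quantale itself is the case of the identity
  nucleus.\<close>

section \<open>Products of subsets of a semigroup\<close>

lemma subset_mult_mono: "A \<subseteq> A' \<Longrightarrow> B \<subseteq> B' \<Longrightarrow> subset_mult f A B \<subseteq> subset_mult f A' B'"
  unfolding subset_mult_def by blast

lemma subset_mult_Union_right: "subset_mult f A (\<Union>S) = (\<Union>B\<in>S. subset_mult f A B)"
  unfolding subset_mult_def by blast

lemma subset_mult_Union_left: "subset_mult f (\<Union>S) B = (\<Union>A\<in>S. subset_mult f A B)"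
  unfolding subset_mult_def by blast

lemma (in semigroup_on) subset_mult_closed:
  "A \<subseteq> X \<Longrightarrow> B \<subseteq> X \<Longrightarrow> subset_mult f A B \<subseteq> X"
  unfolding subset_mult_def using closed by blast

lemma (in semigroup_on) subset_mult_assoc:
  assumes "A \<subseteq> X" "B \<subseteq> X" "C \<subseteq> X"
  shows "subset_mult f (subset_mult f A B) C = subset_mult f A (subset_mult f B C)"
proof (rule Set.set_eqI)
  fix x
  have "x \<in> subset_mult f (subset_mult f A B) C \<longleftrightarrow> (\<exists>a\<in>A. \<exists>b\<in>B. \<exists>c\<in>C. x = f (f a b) c)"
    unfolding subset_mult_def by blast
  \<comment> \<open>The quantifiers stay bounded so that \<open>bex_cong\<close> supplies the
    memberships in \<open>A\<close>, \<open>B\<close>, \<open>C\<close>, and hence in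
    \<open>X\<close>, under which \<open>assoc\<close> applies.\<close>
  also have "\<dots> \<longleftrightarrow> (\<exists>a\<in>A. \<exists>b\<in>B. \<exists>c\<in>C. x = f a (f b c))"
    by (intro bex_cong refl) (use assms assoc in \<open>simp add: subset_iff\<close>)
  also have "\<dots> \<longleftrightarrow> x \<in> subset_mult f A (subset_mult f B C)"
    unfolding subset_mult_def by blast
  finally show "x \<in> subset_mult f (subset_mult f A B) C
    \<longleftrightarrow> x \<in> subset_mult f A (subset_mult f B C)" .
qed

section \<open>The quantale of fixed points of a nucleus\<close>

definition fixpoint_quantale ::
    "'a set \<Rightarrow> ('a \<Rightarrow> 'a \<Rightarrow> 'a) \<Rightarrow> ('a set \<Rightarrow> 'a set) \<Rightarrow> 'a set quantale"
  where "fixpoint_quantale X f j =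
    \<lparr>carrier = {A. A \<subseteq> X \<and> A = j A}, eq = (=), le = (\<subseteq>), qmult = (\<lambda>A B. j (subset_mult f A B))\<rparr>"

lemma polar_quantale_eq:
  "polar_quantale X f Y R = fixpoint_quantale X f (polar_closure X Y R)"
  unfolding polar_quantale_def fixpoint_quantale_def ..

lemma powerset_quantale_eq: "powerset_quantale X f = fixpoint_quantale X f (\<lambda>A. A)"
  unfolding powerset_quantale_def fixpoint_quantale_def by (simp add: Pow_def)

text \<open>Membership is oriented as \<open>j A = A\<close>, so that it serves the simplifier as a
  terminating rewrite rule.\<close>

lemma fixpoint_quantale_simps [simp]:
  "carrier (fixpoint_quantale X f j) = {A. A \<subseteq> X \<and> j A = A}"
  "eq (fixpoint_quantale X f j) = (=)"
  "A \<sqsubseteq>\<^bsub>fixpoint_quantale X f j\<^esub> B \<longleftrightarrow> A \<subseteq> B"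
  "A \<otimes>\<^bsub>fixpoint_quantale X f j\<^esub> B = j (subset_mult f A B)"
  unfolding fixpoint_quantale_def by auto

text \<open>The axioms speak only of subsets of \<open>X\<close> because a lower polar always lies
  in \<open>X\<close>, so the polar closure cannot be extensive on other sets.\<close>

locale subset_nucleus = semigroup_on +
  fixes j :: "'a set \<Rightarrow> 'a set"
  assumes cl_closed: "A \<subseteq> X \<Longrightarrow> j A \<subseteq> X"
    and cl_extensive: "A \<subseteq> X \<Longrightarrow> A \<subseteq> j A"
    and cl_mono: "A \<subseteq> B \<Longrightarrow> B \<subseteq> X \<Longrightarrow> j A \<subseteq> j B"
    and cl_idem: "A \<subseteq> X \<Longrightarrow> j (j A) = j A"
    and cl_mult: "A \<subseteq> X \<Longrightarrow> B \<subseteq> X \<Longrightarrow> subset_mult f (j A) (j B) \<subseteq> j (subset_mult f A B)"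
begin

abbreviation "Q \<equiv> fixpoint_quantale X f j"

text \<open>Monotonicity and idempotence squeeze the closure:
  \<open>j A \<subseteq> j B \<subseteq> j (j A) = j A\<close>.\<close>

lemma cl_eqI:
  assumes "A \<subseteq> B" "B \<subseteq> j A" "A \<subseteq> X"
  shows "j B = j A"
proof
  have "j A \<subseteq> X"
    using assms(3) by (rule cl_closed)
  then show "j B \<subseteq> j A"
    using cl_mono[OF assms(2)] cl_idem[OF assms(3)] by simp
  show "j A \<subseteq> j B"
    using assms(1,2) \<open>j A \<subseteq> X\<close> by (intro cl_mono) auto
qed

lemma cl_Union:
  assumes "\<And>A. A \<in> S \<Longrightarrow> A \<subseteq> X"
  shows "j (\<Union>A\<in>S. j A) = j (\<Union>S)"
proof (rule cl_eqI)
  show "\<Union>S \<subseteq> X"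
    using assms by (rule Union_least)
  show "\<Union>S \<subseteq> (\<Union>A\<in>S. j A)"
    using cl_extensive[OF assms] by blast
  show "(\<Union>A\<in>S. j A) \<subseteq> j (\<Union>S)"
    using \<open>\<Union>S \<subseteq> X\<close> by (intro UN_least cl_mono Union_upper)
qed

lemma cl_mult_both:
  assumes "A \<subseteq> X" "B \<subseteq> X"
  shows "j (subset_mult f (j A) (j B)) = j (subset_mult f A B)"
  by (intro cl_eqI subset_mult_mono cl_extensive cl_mult subset_mult_closed assms)

text \<open>By idempotence both sides equal the closure of \<open>subset_mult f (j A) (j B)\<close>:
  apply \<open>cl_mult_both\<close> once to \<open>A\<close> and \<open>j B\<close>, once to
  \<open>A\<close> and \<open>B\<close>.\<close>

lemma cl_mult_right:
  assumes "A \<subseteq> X" "B \<subseteq> X"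
  shows "j (subset_mult f A (j B)) = j (subset_mult f A B)"
  using cl_mult_both[of A "j B"] cl_mult_both[of A B] assms by (simp add: cl_closed cl_idem)

lemma cl_mult_left:
  assumes "A \<subseteq> X" "B \<subseteq> X"
  shows "j (subset_mult f (j A) B) = j (subset_mult f A B)"
  using cl_mult_both[of "j A" B] cl_mult_both[of A B] assms by (simp add: cl_closed cl_idem)

lemma partial_order_fixpoints: "partial_order Q"
  by unfold_locales auto

lemma least_Upper:
  assumes "S \<subseteq> carrier Q"
  shows "least Q (j (\<Union>S)) (Upper Q S)"
proof -
  have SX: "\<Union>S \<subseteq> X"
    using assms by auto
  have "j (\<Union>S) \<in> Upper Q S"
    using assms SX cl_closed[OF SX] cl_idem[OF SX] cl_extensive[OF SX] by (auto simp: Upper_def)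
  \<comment> \<open>An upper bound is a closed set containing the union, so it contains the closure
    of the union.\<close>
  moreover have "j (\<Union>S) \<subseteq> U" if "U \<in> Upper Q S" for U
  proof -
    have U: "U \<subseteq> X" "j U = U"
      using that by (auto simp: Upper_def)
    have "\<Union>S \<subseteq> U"
      using that assms unfolding Upper_def by fastforce
    with U show ?thesis
      using cl_mono[of "\<Union>S" U] by simp
  qed
  ultimately show ?thesis
    by (auto simp: least_def Upper_def)
qed

text \<open>The union of all lower bounds stays inside \<open>X\<close> even for empty
  \<open>S\<close>, where an intersection over \<open>S\<close> would be the whole type. It is
  closed because its closure is again a lower bound and hence one of the sets united.\<close>

lemma greatest_Lower:
  assumes "S \<subseteq> carrier Q"
  shows "greatest Q (\<Union>(Lower Q S)) (Lower Q S)"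
proof -
  let ?G = "\<Union>(Lower Q S)"
  have GX: "?G \<subseteq> X"
    by (auto simp: Lower_def)
  have "j ?G \<subseteq> A" if "A \<in> S" for A
  proof -
    have "A \<subseteq> X" "j A = A"
      using that assms by auto
    moreover have "?G \<subseteq> A"
      using that assms unfolding Lower_def by fastforce
    ultimately show ?thesis
      using cl_mono[of ?G A] by simp
  qed
  then have "j ?G \<in> Lower Q S"
    using cl_closed[OF GX] cl_idem[OF GX] by (auto simp: Lower_def)
  then have "j ?G = ?G"
    using cl_extensive[OF GX] by blast
  with \<open>j ?G \<in> Lower Q S\<close> show ?thesis
    by (auto simp: greatest_def Lower_def)
qed

lemma Sup_eq:
  assumes "S \<subseteq> carrier Q"
  shows "\<Squnion>\<^bsub>Q\<^esub> S = j (\<Union>S)"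
proof -
  interpret partial_order Q
    by (rule partial_order_fixpoints)
  \<comment> \<open>\<open>sup_def\<close> chooses some least upper bound; antisymmetry then
    identifies the choice with the closure of the union.\<close>
  have "least Q (\<Squnion>\<^bsub>Q\<^esub> S) (Upper Q S)"
    unfolding sup_def by (rule someI) (rule least_Upper[OF assms])
  then show ?thesis
    using least_unique least_Upper[OF assms] by blast
qed

lemma quantale_fixpoints: "quantale Q"
proof -
  have "complete_lattice Q"
  proof (rule complete_lattice.intro)
    show "partial_order Q"
      by (rule partial_order_fixpoints)
    show "complete_lattice_axioms Q"
      using least_Upper greatest_Lower by (intro complete_lattice_axioms.intro) blast+
  qed
  moreover have "quantale_axioms Q"
  proof
    fix A B assume "A \<in> carrier Q" "B \<in> carrier Q"
    then show "A \<otimes>\<^bsub>Q\<^esub> B \<in> carrier Q"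
      by (simp add: subset_mult_closed cl_closed cl_idem)
  next
    fix A B C assume "A \<in> carrier Q" "B \<in> carrier Q" "C \<in> carrier Q"
    then show "(A \<otimes>\<^bsub>Q\<^esub> B) \<otimes>\<^bsub>Q\<^esub> C = A \<otimes>\<^bsub>Q\<^esub> (B \<otimes>\<^bsub>Q\<^esub> C)"
      \<comment> \<open>Dropping the inner closures leaves the closure of a triple product on both
        sides.\<close>
      by (simp add: cl_mult_left cl_mult_right subset_mult_closed subset_mult_assoc)
  next
    fix A S assume A: "A \<in> carrier Q" and S: "S \<subseteq> carrier Q"
    then have SX: "\<Union>S \<subseteq> X"
      by auto
    have AB: "subset_mult f A B \<subseteq> X" "subset_mult f B A \<subseteq> X" if "B \<in> S" for B
    proof -
      have "A \<subseteq> X" "B \<subseteq> X"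
        using that A S by auto
      then show "subset_mult f A B \<subseteq> X" "subset_mult f B A \<subseteq> X"
        by (simp_all add: subset_mult_closed)
    qed
    then have img: "(\<lambda>B. j (subset_mult f A B)) ` S \<subseteq> carrier Q"
      "(\<lambda>B. j (subset_mult f B A)) ` S \<subseteq> carrier Q"
      using cl_closed cl_idem by (simp_all add: image_subset_iff)
    \<comment> \<open>The closure hidden in the supremum is dropped, the product distributes over
      the union, and \<open>cl_Union\<close> puts a closure back around each product.\<close>
    have "A \<otimes>\<^bsub>Q\<^esub> \<Squnion>\<^bsub>Q\<^esub> S = j (\<Union>B\<in>S. subset_mult f A B)"
      using A SX Sup_eq[OF S] by (simp add: cl_mult_right subset_mult_Union_right)
    also have "\<dots> = j (\<Union>B\<in>S. j (subset_mult f A B))"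
      using cl_Union[of "subset_mult f A ` S"] AB by auto
    also have "\<dots> = \<Squnion>\<^bsub>Q\<^esub> ((\<lambda>B. A \<otimes>\<^bsub>Q\<^esub> B) ` S)"
      using Sup_eq[OF img(1)] by simp
    finally show "A \<otimes>\<^bsub>Q\<^esub> \<Squnion>\<^bsub>Q\<^esub> S = \<Squnion>\<^bsub>Q\<^esub> ((\<lambda>B. A \<otimes>\<^bsub>Q\<^esub> B) ` S)" .
    have "\<Squnion>\<^bsub>Q\<^esub> S \<otimes>\<^bsub>Q\<^esub> A = j (\<Union>B\<in>S. subset_mult f B A)"
      using A SX Sup_eq[OF S] by (simp add: cl_mult_left subset_mult_Union_left)
    also have "\<dots> = j (\<Union>B\<in>S. j (subset_mult f B A))"
      using cl_Union[of "(\<lambda>B. subset_mult f B A) ` S"] AB by auto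
    also have "\<dots> = \<Squnion>\<^bsub>Q\<^esub> ((\<lambda>B. B \<otimes>\<^bsub>Q\<^esub> A) ` S)"
      using Sup_eq[OF img(2)] by simp
    finally show "\<Squnion>\<^bsub>Q\<^esub> S \<otimes>\<^bsub>Q\<^esub> A = \<Squnion>\<^bsub>Q\<^esub> ((\<lambda>B. B \<otimes>\<^bsub>Q\<^esub> A) ` S)" .
  qed
  ultimately show ?thesis
    by (rule quantale.intro)
qed

lemma quantale_hom_cl: "quantale_hom (powerset_quantale X f) Q j"
proof -
  \<comment> \<open>With the identity as nucleus, \<open>P.Sup_eq\<close> says that suprema in the
    powerset quantale are plain unions.\<close>
  interpret P: subset_nucleus X f "\<lambda>A. A"
    by unfold_locales auto
  have "quantale_hom_axioms P.Q Q j"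
  proof
    fix A assume "A \<in> carrier P.Q"
    then show "j A \<in> carrier Q"
      by (simp add: cl_closed cl_idem)
  next
    fix S assume S: "S \<subseteq> carrier P.Q"
    then have SX: "\<And>A. A \<in> S \<Longrightarrow> A \<subseteq> X"
      by auto
    then have "j ` S \<subseteq> carrier Q"
      by (simp add: image_subset_iff cl_closed cl_idem)
    then show "j (\<Squnion>\<^bsub>P.Q\<^esub> S) = \<Squnion>\<^bsub>Q\<^esub> (j ` S)"
      using P.Sup_eq[OF S] SX by (simp add: Sup_eq cl_Union)
  next
    fix A B assume "A \<in> carrier P.Q" "B \<in> carrier P.Q"
    then show "j (A \<otimes>\<^bsub>P.Q\<^esub> B) = j A \<otimes>\<^bsub>Q\<^esub> j B"
      by (simp add: cl_mult_both)
  qed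
  then show ?thesis
    unfolding powerset_quantale_eq
    by (intro quantale_hom.intro P.quantale_fixpoints quantale_fixpoints)
qed

end

section \<open>Polar closure of a residuated relation\<close>

lemma polar_closure_mult:
  assumes "semigroup_on X f" "residuated X f Y R" "A \<subseteq> X" "B \<subseteq> X"
  shows "subset_mult f (polar_closure X Y R A) (polar_closure X Y R B)
    \<subseteq> polar_closure X Y R (subset_mult f A B)"
proof
  interpret semigroup_on X f by fact
  obtain l r
    where l: "\<forall>y\<in>Y. \<forall>x\<in>X. l y x \<in> Y" and r: "\<forall>x\<in>X. \<forall>y\<in>Y. r x y \<in> Y"
      and res: "\<forall>x\<in>X. \<forall>x'\<in>X. \<forall>y\<in>Y.
        ((f x x', y) \<in> R \<longleftrightarrow> (x, l y x') \<in> R) \<and> ((x, l y x') \<in> R \<longleftrightarrow> (x', r x y) \<in> R)"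
    using assms(2) unfolding residuated_def by (elim exE conjE)
  fix c assume "c \<in> subset_mult f (polar_closure X Y R A) (polar_closure X Y R B)"
  then obtain a b where c: "c = f a b"
    and a: "a \<in> X" "\<And>y. y \<in> up_polar Y R A \<Longrightarrow> (a, y) \<in> R"
    and b: "b \<in> X" "\<And>y. y \<in> up_polar Y R B \<Longrightarrow> (b, y) \<in> R"
    unfolding subset_mult_def polar_closure_def down_polar_def by blast
  \<comment> \<open>The factors are replaced one at a time. For \<open>b'\<close> in
    \<open>B\<close>, \<open>l y b'\<close> is in the upper polar of \<open>A\<close>, so
    \<open>a\<close> is related to it, that is, \<open>b'\<close> is related to
    \<open>r a y\<close>. Thus \<open>r a y\<close> is in the upper polar of \<open>B\<close>, so
    \<open>b\<close> is related to it, and residuation turns this back into the claim.\<close>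
  have "(f a b, y) \<in> R" if "y \<in> up_polar Y R (subset_mult f A B)" for y
  proof -
    have y: "y \<in> Y" and fy: "\<And>a' b'. a' \<in> A \<Longrightarrow> b' \<in> B \<Longrightarrow> (f a' b', y) \<in> R"
      using that unfolding up_polar_def subset_mult_def by blast+
    have "(b', r a y) \<in> R" if "b' \<in> B" for b'
    proof -
      have b': "b' \<in> X"
        using that assms(4) by blast
      then have "l y b' \<in> up_polar Y R A"
        using fy[OF _ that] y l res assms(3) by (simp add: up_polar_def subset_iff)
      then show ?thesis
        using a b' y res by blast
    qed
    then have "r a y \<in> up_polar Y R B"
      using a(1) r y by (simp add: up_polar_def)
    then show ?thesis
      using a(1) b y res by blast
  qed
  then show "c \<in> polar_closure X Y R (subset_mult f A B)"
    unfolding c polar_closure_def down_polar_def using closed a(1) b(1) by blast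
qed

lemma subset_nucleus_polar_closure:
  assumes "semigroup_on X f" "residuated X f Y R"
  shows "subset_nucleus X f (polar_closure X Y R)"
proof (rule subset_nucleus.intro)
  show "subset_nucleus_axioms X f (polar_closure X Y R)"
  proof
    fix A B assume "A \<subseteq> X" "B \<subseteq> X"
    then show "subset_mult f (polar_closure X Y R A) (polar_closure X Y R B)
        \<subseteq> polar_closure X Y R (subset_mult f A B)"
      by (rule polar_closure_mult[OF assms])
  \<comment> \<open>The other four axioms hold because the two polars form an antitone Galois
    connection.\<close>
  qed (unfold polar_closure_def up_polar_def down_polar_def, blast+)
qed fact

theorem proposition4p3:
  fixes X :: "'a set" and f :: "'a \<Rightarrow> 'a \<Rightarrow> 'a" and Y :: "'b set" and R :: "('a \<times> 'b) set"
  assumes "semigroup_on X f"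
    and "R \<subseteq> X \<times> Y"
    and "residuated X f Y R"
  shows "quantale (polar_quantale X f Y R) \<and>
    (\<forall>A\<in>carrier (polar_quantale X f Y R). \<forall>B\<in>carrier (polar_quantale X f Y R).
      A \<otimes>\<^bsub>polar_quantale X f Y R\<^esub> B = polar_closure X Y R (subset_mult f A B)) \<and>
    (\<forall>(I :: 'i set) A. (\<forall>i\<in>I. A i \<in> carrier (polar_quantale X f Y R)) \<longrightarrow>
      \<Squnion>\<^bsub>polar_quantale X f Y R\<^esub> (A ` I) = polar_closure X Y R (\<Union>i\<in>I. A i)) \<and>
    quantale_hom (powerset_quantale X f) (polar_quantale X f Y R) (polar_closure X Y R)"
proof -
  interpret subset_nucleus X f "polar_closure X Y R"
    using assms(1,3) by (rule subset_nucleus_polar_closure)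
  show ?thesis
    unfolding polar_quantale_eq
  proof (intro conjI ballI allI impI quantale_fixpoints quantale_hom_cl)
    fix I :: "'i set" and A
    assume "\<forall>i\<in>I. A i \<in> carrier Q"
    then have "A ` I \<subseteq> carrier Q"
      by blast
    then show "\<Squnion>\<^bsub>Q\<^esub> (A ` I) = polar_closure X Y R (\<Union>i\<in>I. A i)"
      by (rule Sup_eq)
  \<comment> \<open>What remains is the formula for the multiplication, true by definition.\<close>
  qed simp
qed

end
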